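(* Let $\langle\mathcal S,\mathcal A,\mathcal P,\mathcal R,\gamma\rangle$ be a discounted Markov decision process with $\gamma\in(0,1)$, let $\alpha>0$, and let $\pi$ be a stationary policy. Assume: (a) for each $s\in\mathcal S$, if $a\sim\pi(\cdot\mid s)$, then $\log\pi(a\mid s)$ is well defined almost surely; (b) $\sup_{(s,a)\in\mathcal S\times\mathcal A}\mathbb E_{r\sim R(s,a),\,(s',a')\sim\mathcal P^\pi(\cdot\mid s,a)}\bigl[|r-\gamma\alpha\log\pi(a'\mid s')|\bigr]<\infty$; (c) for every $F\in\mathcal X^{\mathrm{cdf}}$ and $x\in\mathbb R$, the map $(s,a)\mapsto\mathbb E_{r\sim R(s,a),\,(s',a')\sim\mathcal P^\pi(\cdot\mid s,a)}\bigl[F(s',a')\bigl(\tfrac{x-r}{\gamma}+\alpha\log\pi(a'\mid s')\bigr)\bigr]$ is measurable. Then the operator $\mathcal T^\pi_{\mathrm{cdf}}$ maps $\mathcal X^{\mathrm{cdf}}$ into itself: for every $F\in\mathcal X^{\mathrm{cdf}}$ one has $\mathcal T^\pi_{\mathrm{cdf}}F\in\mathcal X^{\mathrm{cdf}}$.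
   Context: MDP: $\mathcal S,\mathcal A$ are measurable spaces (states, actions), $\mathcal P(\cdot\mid s,a)$ is a transition kernel on $\mathcal S$, $\mathcal R:\mathcal S\times\mathcal A\times\mathcal S\to\mathbb R$ is a (measurable) reward function. A stationary policy $\pi$ assigns to each $s$ a probability distribution $\pi(\cdot\mid s)$ on $\mathcal A$; $\pi(a\mid s)$ denotes the value of its probability mass function / density. Sampling: $(s',a')\sim\mathcal P^\pi(\cdot\mid s,a)$ means $s'\sim\mathcal P(\cdot\mid s,a)$ and then $a'\sim\pi(\cdot\mid s')$; $r\sim R(s,a)$ denotes the one-step reward $r=\mathcal R(s,a,s')$ generated by the same next state $s'$. Cramér distance between probability laws on $\mathbb R$ with CDFs $F_{P_1},F_{P_2}$: $d_C(P_1,P_2)=\bigl(\int_{\mathbb R}(F_{P_1}(x)-F_{P_2}(x))^2dx\bigr)^{1/2}$. $\delta_0$ is the Dirac law at $0$, with CDF $\mathbf 1\{x\ge0\}$. $\Gamma_F$ is the set of CDFs $F_P$ of laws $P$ on $\mathbb R$ with $d_C(P,\delta_0)<\infty$. $\mathcal X^{\mathrm{cdf}}$ is the set of all CDF fields $F:(s,a)\mapsto F(s,a)\in\Gamma_F$ (with $(s,a)\mapsto F(s,a)(x)$ measurable for each $x\in\mathbb R$) such that $\sup_{(s,a)}\int_{\mathbb R}(F(s,a)(x)-\mathbf 1\{x\ge0\})^2dx<\infty$. Operator: for $F\in\mathcal X^{\mathrm{cdf}}$, $(\mathcal T^\pi_{\mathrm{cdf}}F)(s,a)(x):=\mathbb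 E_{r\sim R(s,a),\,(s',a')\sim\mathcal P^\pi(\cdot\mid s,a)}\bigl[F(s',a')\bigl(\tfrac{x-r}{\gamma}+\alpha\log\pi(a'\mid s')\bigr)\bigr]$. *)

theory Defs
  imports "HOL-Probability.Probability"
begin

text \<open>The distance may be infinite, and there is no square root on \<open>ennreal\<close> in the library.\<close>

definition ennsqrt :: "ennreal \<Rightarrow> ennreal" where
  "ennsqrt u = (if u = \<infinity> then \<infinity> else ennreal (sqrt (enn2real u)))"

definition cramer_dist :: "real measure \<Rightarrow> real measure \<Rightarrow> ennreal" where
  "cramer_dist P\<^sub>1 P\<^sub>2 =
     ennsqrt (\<integral>\<^sup>+x. ennreal ((cdf P\<^sub>1 x - cdf P\<^sub>2 x)\<^sup>2) \<partial>lborel)"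

definition Gamma_cdf :: "(real \<Rightarrow> real) set" where
  "Gamma_cdf = {cdf P | P. real_distribution P \<and> cramer_dist P (return borel 0) < \<infinity>}"

text \<open>
  Measurable spaces are given by measures of which only the carrier and the sigma-algebra matter.
  A CDF field is a total HOL function constrained only on the carrier of the state-action space.
\<close>

definition cdf_fields ::
    "'s measure \<Rightarrow> 'a measure \<Rightarrow> ('s \<times> 'a \<Rightarrow> real \<Rightarrow> real) set" where
  "cdf_fields S A =
     {F. (\<forall>z\<in>space (S \<Otimes>\<^sub>M A). F z \<in> Gamma_cdf) \<and>
         (\<forall>x. (\<lambda>z. F z x) \<in> borel_measurable (S \<Otimes>\<^sub>M A)) \<and>
         (SUP z\<in>space (S \<Otimes>\<^sub>M A).
            \<integral>\<^sup>+x. ennreal ((F z x - indicator {0..} x)\<^sup>2) \<partial>lborel) < \<infinity>}"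

locale discounted_mdp =
  fixes S :: "'s measure" and A :: "'a measure"
    and P :: "'s \<times> 'a \<Rightarrow> 's measure"
    and R :: "'s \<times> 'a \<times> 's \<Rightarrow> real"
    and \<gamma> :: real
  assumes transition_kernel: "P \<in> S \<Otimes>\<^sub>M A \<rightarrow>\<^sub>M prob_algebra S"
    and measurable_reward: "R \<in> borel_measurable (S \<Otimes>\<^sub>M A \<Otimes>\<^sub>M S)"
    and discount: "0 < \<gamma>" "\<gamma> < 1"

text \<open>
  \<open>\<pi> s\<close> is the law of the action in state \<open>s\<close> and \<open>p s a\<close> the value of its density with respect
  to the reference measure \<open>\<nu>\<close>; a probability mass function is the case of a counting measure \<open>\<nu>\<close>.
  No sigma-finiteness is imposed on \<open>\<nu>\<close>, so that counting measure on an uncountable set is allowed.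
\<close>

locale stationary_policy =
  fixes S :: "'s measure" and A :: "'a measure"
    and \<nu> :: "'a measure"
    and \<pi> :: "'s \<Rightarrow> 'a measure"
    and p :: "'s \<Rightarrow> 'a \<Rightarrow> real"
  assumes policy_kernel: "\<pi> \<in> S \<rightarrow>\<^sub>M prob_algebra A"
    and sets_reference: "sets \<nu> = sets A"
    and measurable_density: "(\<lambda>(s, a). p s a) \<in> borel_measurable (S \<Otimes>\<^sub>M A)"
    and density_nonneg: "\<And>s a. s \<in> space S \<Longrightarrow> a \<in> space A \<Longrightarrow> 0 \<le> p s a"
    and policy_density: "\<And>s. s \<in> space S \<Longrightarrow> \<pi> s = density \<nu> (\<lambda>a. ennreal (p s a))"

definition policy_transition ::
    "'s measure \<Rightarrow> 'a measure \<Rightarrow> ('s \<times> 'a \<Rightarrow> 's measure) \<Rightarrow> ('s \<Rightarrow> 'a measure) \<Rightarrow>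
     's \<times> 'a \<Rightarrow> ('s \<times> 'a) measure" where
  "policy_transition S A P \<pi> z =
     P z \<bind> (\<lambda>s'. \<pi> s' \<bind> (\<lambda>a'. return (S \<Otimes>\<^sub>M A) (s', a')))"

text \<open>The reward is a function of the same next state \<open>s'\<close> that is sampled jointly with \<open>a'\<close>.\<close>

definition T_cdf ::
    "'s measure \<Rightarrow> 'a measure \<Rightarrow> ('s \<times> 'a \<Rightarrow> 's measure) \<Rightarrow> ('s \<times> 'a \<times> 's \<Rightarrow> real) \<Rightarrow>
     real \<Rightarrow> real \<Rightarrow> ('s \<Rightarrow> 'a measure) \<Rightarrow> ('s \<Rightarrow> 'a \<Rightarrow> real) \<Rightarrow>
     ('s \<times> 'a \<Rightarrow> real \<Rightarrow> real) \<Rightarrow> 's \<times> 'a \<Rightarrow> real \<Rightarrow> real" where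
  "T_cdf S A P R \<gamma> \<alpha> \<pi> p F = (\<lambda>(s, a) x.
     \<integral>(s', a'). F (s', a') ((x - R (s, a, s')) / \<gamma> + \<alpha> * ln (p s' a'))
       \<partial>policy_transition S A P \<pi> (s, a))"

end

theory Submission
  imports Defs
begin

text \<open>
  The function \<open>x \<mapsto> F z ((x - t) / \<gamma>)\<close> is the distribution function of \<open>\<gamma> Y + t\<close> when \<open>Y\<close> has
  distribution function \<open>F z\<close>. Hence \<open>T F (s, a)\<close> is the distribution function of a mixture of
  affine images, taken over \<open>(s', a')\<close> with shift \<open>t = R (s, a, s') - \<gamma> \<alpha> ln (p s' a')\<close>. The squared
  distance to the Dirac law at \<open>0\<close> is convex in the law (Jensen and Tonelli), and for one affine
  image it is at most \<open>2\<gamma>\<close> times the old one plus \<open>2 \<bar>t\<bar>\<close>, the latter because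
  \<open>\<integral> (1{x \<ge> t} - 1{x \<ge> 0})\<^sup>2 dx = \<bar>t\<bar>\<close>.
\<close>

section \<open>The squared Cramer distance to the Dirac law at 0, and fields as kernels\<close>

definition cramer_energy :: "(real \<Rightarrow> real) \<Rightarrow> ennreal" where
  "cramer_energy f = (\<integral>\<^sup>+x. ennreal ((f x - indicator {0..} x)\<^sup>2) \<partial>lborel)"

lemma ennsqrt_less_top_iff: "ennsqrt u < \<infinity> \<longleftrightarrow> u < \<infinity>"
  by (auto simp: ennsqrt_def less_top)

lemma cdf_return_0: "cdf (return borel 0) = (indicator {0..} :: real \<Rightarrow> real)"
  by (auto simp: cdf_def fun_eq_iff measure_return indicator_def)

lemma mem_Gamma_cdf_iff:
  "f \<in> Gamma_cdf \<longleftrightarrow> (\<exists>Q. real_distribution Q \<and> f = cdf Q) \<and> cramer_energy f < \<infinity>"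
  unfolding Gamma_cdf_def cramer_dist_def cdf_return_0 ennsqrt_less_top_iff cramer_energy_def
  by auto

text \<open>A finite supremum of the energies already bounds each of them, so membership in
  \<open>Gamma_cdf\<close> reduces to being the CDF of some law.\<close>

lemma mem_cdf_fields_iff:
  "F \<in> cdf_fields S A \<longleftrightarrow>
     (\<forall>z\<in>space (S \<Otimes>\<^sub>M A). \<exists>Q. real_distribution Q \<and> F z = cdf Q) \<and>
     (\<forall>x. (\<lambda>z. F z x) \<in> borel_measurable (S \<Otimes>\<^sub>M A)) \<and>
     (SUP z\<in>space (S \<Otimes>\<^sub>M A). cramer_energy (F z)) < \<infinity>"
proof -
  have "cramer_energy (F z) < \<infinity>"
    if "(SUP z\<in>space (S \<Otimes>\<^sub>M A). cramer_energy (F z)) < \<infinity>" "z \<in> space (S \<Otimes>\<^sub>M A)" for z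
    using that(1) SUP_upper[OF that(2), of "\<lambda>z. cramer_energy (F z)"] by (rule le_less_trans[rotated])
  then show ?thesis
    unfolding cdf_fields_def mem_Gamma_cdf_iff cramer_energy_def[symmetric] by auto
qed

text \<open>The half-lines \<open>{..x}\<close> form an intersection-stable generator of the Borel
  sets, so testing a family of laws on them suffices. This turns a CDF field into a kernel, to which
  \<open>bind\<close> applies.\<close>

lemma measurable_prob_algebra_cdf:
  fixes Q :: "'z \<Rightarrow> real measure"
  assumes Q: "\<And>z. z \<in> space M \<Longrightarrow> real_distribution (Q z)"
    and cdf: "\<And>x. (\<lambda>z. cdf (Q z) x) \<in> borel_measurable M"
  shows "Q \<in> M \<rightarrow>\<^sub>M prob_algebra borel"
proof (rule measurable_prob_algebra_generated[where \<Omega> = UNIV and G = "range atMost"])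
  show "sets borel = sigma_sets UNIV (range (atMost :: real \<Rightarrow> real set))"
    by (subst borel_eq_atMost) simp
  show "Int_stable (range (atMost :: real \<Rightarrow> real set))"
    by (auto simp: Int_stable_def)
next
  fix z assume z: "z \<in> space M"
  then interpret real_distribution "Q z" by (rule Q)
  show "prob_space (Q z)" by (rule prob_space_axioms)
  show "sets (Q z) = sets borel" by (rule events_eq_borel)
next
  fix B :: "real set" assume "B \<in> range atMost"
  then obtain x where B: "B = {..x}" by auto
  have "(\<lambda>z. ennreal (cdf (Q z) x)) \<in> borel_measurable M"
    using cdf by measurable
  moreover have "emeasure (Q z) B = ennreal (cdf (Q z) x)" if "z \<in> space M" for z
  proof -
    interpret real_distribution "Q z" using Q[OF that] .
    show ?thesis by (simp add: B cdf_def emeasure_eq_measure)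
  qed
  ultimately show "(\<lambda>z. emeasure (Q z) B) \<in> borel_measurable M"
    by (simp cong: measurable_cong)
qed auto

section \<open>Mixtures of laws\<close>

lemma (in prob_space) square_expectation_le:
  fixes X :: "'a \<Rightarrow> real"
  assumes "integrable M X" "integrable M (\<lambda>z. (X z)\<^sup>2)"
  shows "(expectation X)\<^sup>2 \<le> expectation (\<lambda>z. (X z)\<^sup>2)"
  using variance_positive[of X] variance_eq[OF assms] by simp

text \<open>The half-lines \<open>{..x}\<close> are sections of the measurable set of all ((x, z),
  y) with y \<le> x, and a kernel measures sections measurably. Tonelli in the energy bound needs
  this joint form.\<close>

lemma measurable_cdf_kernel:
  assumes K: "K \<in> M \<rightarrow>\<^sub>M prob_algebra borel"
  shows "(\<lambda>(x, z). cdf (K z) x) \<in> borel_measurable (borel \<Otimes>\<^sub>M M)"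
proof -
  have "(SIGMA w:space ((borel :: real measure) \<Otimes>\<^sub>M M). {..fst w}) =
      {v \<in> space ((borel \<Otimes>\<^sub>M M) \<Otimes>\<^sub>M borel). snd v \<le> fst (fst v)}"
    by (auto simp: space_pair_measure)
  also have "\<dots> \<in> sets ((borel \<Otimes>\<^sub>M M) \<Otimes>\<^sub>M borel)"
    by measurable
  finally have "(\<lambda>w. measure (K (snd w)) {..fst w}) \<in> borel_measurable (borel \<Otimes>\<^sub>M M)"
    by (rule measure_measurable_prob_algebra2) (rule measurable_compose[OF measurable_snd K])
  then show ?thesis
    by (simp add: cdf_def split_beta')
qed

lemma kernel_real_distribution:
  assumes "K \<in> M \<rightarrow>\<^sub>M prob_algebra borel" "z \<in> space M"
  shows "real_distribution (K z)"
  using measurable_space[OF assms]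
  by (auto simp: space_prob_algebra real_distribution_def real_distribution_axioms_def)

context prob_space
begin

lemma real_distribution_bind:
  assumes "K \<in> M \<rightarrow>\<^sub>M prob_algebra borel"
  shows "real_distribution (M \<bind> K)"
proof -
  have "M \<in> space (prob_algebra M)"
    by (simp add: space_prob_algebra prob_space_axioms)
  from prob_space_bind'[OF this assms] sets_bind'[OF this assms] show ?thesis
    by (simp add: real_distribution_def real_distribution_axioms_def)
qed

lemma cdf_bind:
  assumes "K \<in> M \<rightarrow>\<^sub>M prob_algebra borel"
  shows "cdf (M \<bind> K) x = (\<integral>z. cdf (K z) x \<partial>M)"
  unfolding cdf_def
  by (rule measure_bind[OF measurable_prob_algebraD[OF assms]]) simp

lemma cramer_energy_bind_le:
  assumes K: "K \<in> M \<rightarrow>\<^sub>M prob_algebra borel"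
  shows "cramer_energy (cdf (M \<bind> K)) \<le> (\<integral>\<^sup>+z. cramer_energy (cdf (K z)) \<partial>M)"
proof -
  note measurable_cdf_kernel[OF K, measurable]
  define D where "D x z = cdf (K z) x - indicator {0..} x" for x z
  have D[measurable]: "(\<lambda>(x, z). D x z) \<in> borel_measurable (lborel \<Otimes>\<^sub>M M)"
    unfolding D_def by measurable
  \<comment> \<open>Both terms of \<open>D\<close> lie in [0, 1]. On a probability space this makes
    \<open>D x\<close> and its square integrable, as Jensen requires.\<close>
  have D_bound: "\<bar>D x z\<bar> \<le> 1" if "z \<in> space M" for x z
  proof -
    interpret K: real_distribution "K z" using kernel_real_distribution[OF K that] .
    show ?thesis
      using K.cdf_nonneg[of x] K.cdf_bounded_prob[of x] by (auto simp: D_def indicator_def)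
  qed
  have Dx[measurable]: "D x \<in> borel_measurable M" for x
    by measurable
  have int_D: "integrable M (D x)" for x
    by (rule integrable_const_bound[where B = 1]) (auto simp: D_bound)
  have int_D2: "integrable M (\<lambda>z. (D x z)\<^sup>2)" for x
    by (rule integrable_const_bound[where B = 1]) (auto simp: D_bound abs_square_le_1)
  have "ennreal ((cdf (M \<bind> K) x - indicator {0..} x)\<^sup>2) \<le> (\<integral>\<^sup>+z. ennreal ((D x z)\<^sup>2) \<partial>M)" for x
  proof -
    \<comment> \<open>Adding the constant indicator back to \<open>D x\<close> gives integrability
      of the CDF values. The indicator then moves under the expectation because \<open>M\<close> has
      mass 1.\<close>
    have "integrable M (\<lambda>z. cdf (K z) x)"
      using Bochner_Integration.integrable_add[OF int_D[of x] integrable_const[of "indicator {0..} x"]]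
      by (simp add: D_def)
    then have "cdf (M \<bind> K) x - indicator {0..} x = expectation (D x)"
      unfolding cdf_bind[OF K] D_def by (simp add: prob_space)
    also have "(expectation (D x))\<^sup>2 \<le> expectation (\<lambda>z. (D x z)\<^sup>2)"
      using int_D int_D2 by (rule square_expectation_le)
    finally show ?thesis
      by (simp add: nn_integral_eq_integral[OF int_D2] ennreal_leI)
  qed
  then have "cramer_energy (cdf (M \<bind> K)) \<le> (\<integral>\<^sup>+x. \<integral>\<^sup>+z. ennreal ((D x z)\<^sup>2) \<partial>M \<partial>lborel)"
    unfolding cramer_energy_def by (intro nn_integral_mono)
  also have "\<dots> = (\<integral>\<^sup>+z. \<integral>\<^sup>+x. ennreal ((D x z)\<^sup>2) \<partial>lborel \<partial>M)"
  proof -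
    interpret pair_sigma_finite lborel M ..
    show ?thesis by (rule Fubini'[symmetric]) measurable
  qed
  finally show ?thesis
    by (simp add: cramer_energy_def D_def)
qed

end

section \<open>Affine images and their mixtures\<close>

lemma cdf_distr_affine:
  fixes c t :: real
  assumes "real_distribution Q" "0 < c"
  shows "cdf (distr Q borel (\<lambda>y. c * y + t)) x = cdf Q ((x - t) / c)"
proof -
  interpret real_distribution Q by fact
  have "(\<lambda>y. c * y + t) -` {..x} = {..(x - t) / c}"
    using assms(2) by (auto simp: field_simps)
  then show ?thesis
    by (simp add: cdf_def measure_distr)
qed

lemma nn_integral_indicator_diff_square:
  fixes t :: real
  shows "(\<integral>\<^sup>+x. ennreal ((indicator {t..} x - indicator {0..} x)\<^sup>2) \<partial>lborel) = ennreal \<bar>t\<bar>"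
proof -
  \<comment> \<open>The two indicators differ exactly between 0 and t; \<open>min\<close> and
    \<open>max\<close> cover both signs of t.\<close>
  have "ennreal ((indicator {t..} x - indicator {0..} x)\<^sup>2) =
      indicator ({min t 0..<max t 0}) x" for x
    by (auto simp: indicator_def)
  then have "(\<integral>\<^sup>+x. ennreal ((indicator {t..} x - indicator {0..} x)\<^sup>2) \<partial>lborel)
      = emeasure lborel {min t 0..<max t 0}"
    by simp
  also have "\<dots> = ennreal \<bar>t\<bar>"
    by (subst emeasure_lborel_Ico) (auto simp: min_def max_def)
  finally show ?thesis .
qed

text \<open>The comparison passes through \<open>indicator {t..}\<close>, the CDF of the Dirac law
  at t, which is the image of the Dirac law at 0 under y \<mapsto> c y + t. Against it the energy
  scales exactly by c; the factors 2 come from squaring a sum.\<close>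

lemma cramer_energy_affine_le:
  fixes c t :: real
  assumes [measurable]: "f \<in> borel_measurable borel" and c: "0 < c"
  shows "cramer_energy (\<lambda>x. f ((x - t) / c)) \<le> ennreal (2 * c) * cramer_energy f + 2 * ennreal \<bar>t\<bar>"
proof -
  \<comment> \<open>The substitution x = t + c y carries \<open>indicator {t..}\<close> back to
    \<open>indicator {0..}\<close> and contributes the Jacobian c.\<close>
  have scale: "(\<integral>\<^sup>+x. ennreal ((f ((x - t) / c) - indicator {t..} x)\<^sup>2) \<partial>lborel) =
      ennreal c * cramer_energy f"
  proof -
    have "(indicator {t..} (t + c * x) :: real) = indicator {0..} x" for x
      using c by (auto simp: indicator_def zero_le_mult_iff)
    then show ?thesis
      using c
      by (subst nn_integral_real_affine[where c = c and t = t]) (auto simp: cramer_energy_def)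
  qed
  \<comment> \<open>The right side minus the left side equals (a - 2 d + b)^2.\<close>
  have square: "(a - b)\<^sup>2 \<le> 2 * (a - d)\<^sup>2 + 2 * (d - b)\<^sup>2" for a b d :: real
    using zero_le_power2[of "a - 2 * d + b"] by (simp add: power2_eq_square algebra_simps)
  have "cramer_energy (\<lambda>x. f ((x - t) / c)) \<le>
      (\<integral>\<^sup>+x. 2 * ennreal ((f ((x - t) / c) - indicator {t..} x)\<^sup>2) +
        2 * ennreal ((indicator {t..} x - indicator {0..} x)\<^sup>2) \<partial>lborel)"
    unfolding cramer_energy_def
  proof (intro nn_integral_mono)
    fix x :: real
    let ?a = "f ((x - t) / c)" and ?d = "indicator {t..} x :: real" and ?b = "indicator {0..} x :: real"
    have "ennreal ((?a - ?b)\<^sup>2) \<le> ennreal (2 * (?a - ?d)\<^sup>2 + 2 * (?d - ?b)\<^sup>2)"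
      by (rule ennreal_leI) (rule square)
    then show "ennreal ((?a - ?b)\<^sup>2) \<le> 2 * ennreal ((?a - ?d)\<^sup>2) + 2 * ennreal ((?d - ?b)\<^sup>2)"
      by (simp add: ennreal_plus ennreal_mult)
  qed
  also have "\<dots> = 2 * (ennreal c * cramer_energy f) + 2 * ennreal \<bar>t\<bar>"
    by (subst nn_integral_add) (auto simp: nn_integral_cmult scale nn_integral_indicator_diff_square)
  finally show ?thesis
    using c by (simp add: ennreal_mult mult.assoc)
qed

lemma (in prob_space) affine_mixture:
  fixes F :: "'a \<Rightarrow> real \<Rightarrow> real" and Z :: "'a \<Rightarrow> real" and c :: real
  assumes F: "\<And>z. z \<in> space M \<Longrightarrow> \<exists>Q. real_distribution Q \<and> F z = cdf Q"
    and [measurable]: "\<And>x. (\<lambda>z. F z x) \<in> borel_measurable M"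
    and [measurable]: "Z \<in> borel_measurable M"
    and c: "0 < c"
  shows "\<exists>Q. real_distribution Q \<and> (\<lambda>x. \<integral>z. F z ((x - Z z) / c) \<partial>M) = cdf Q"
    and "\<And>C. (\<And>z. z \<in> space M \<Longrightarrow> cramer_energy (F z) \<le> C) \<Longrightarrow>
      cramer_energy (\<lambda>x. \<integral>z. F z ((x - Z z) / c) \<partial>M) \<le>
        ennreal (2 * c) * C + 2 * (\<integral>\<^sup>+z. ennreal \<bar>Z z\<bar> \<partial>M)"
proof -
  \<comment> \<open>The laws are chosen pointwise. The choice is nevertheless measurable, since a
    law on the line is determined by its CDF and the CDF values are measurable by
    assumption.\<close>
  obtain Q where Q: "\<And>z. z \<in> space M \<Longrightarrow> real_distribution (Q z)"
    and FQ: "\<And>z. z \<in> space M \<Longrightarrow> F z = cdf (Q z)"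
    using F by metis
  have "(\<lambda>z. cdf (Q z) x) \<in> borel_measurable M" for x
    using assms(2)[of x] by (simp add: FQ cong: measurable_cong)
  with Q have [measurable]: "Q \<in> M \<rightarrow>\<^sub>M prob_algebra borel"
    by (rule measurable_prob_algebra_cdf)
  define K where "K z = distr (Q z) borel (\<lambda>y. c * y + Z z)" for z
  have K: "K \<in> M \<rightarrow>\<^sub>M prob_algebra borel"
    unfolding K_def by measurable
  have cdf_K: "cdf (K z) = (\<lambda>x. F z ((x - Z z) / c))" if "z \<in> space M" for z
    using that by (simp add: K_def fun_eq_iff FQ cdf_distr_affine[OF Q c])
  have G: "(\<lambda>x. \<integral>z. F z ((x - Z z) / c) \<partial>M) = cdf (M \<bind> K)"
    by (auto simp: fun_eq_iff cdf_bind[OF K] cdf_K intro!: Bochner_Integration.integral_cong)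
  then show "\<exists>Q. real_distribution Q \<and> (\<lambda>x. \<integral>z. F z ((x - Z z) / c) \<partial>M) = cdf Q"
    using real_distribution_bind[OF K] by blast
  fix C assume C: "\<And>z. z \<in> space M \<Longrightarrow> cramer_energy (F z) \<le> C"
  have "cramer_energy (cdf (K z)) \<le> ennreal (2 * c) * C + 2 * ennreal \<bar>Z z\<bar>" if "z \<in> space M" for z
  proof -
    interpret Q: real_distribution "Q z" using Q[OF that] .
    \<comment> \<open>Monotone functions are Borel.\<close>
    have "F z \<in> borel_measurable borel"
      unfolding FQ[OF that] by (intro borel_measurable_mono monoI Q.cdf_nondecreasing)
    from cramer_energy_affine_le[OF this c, of "Z z"] show ?thesis
      unfolding cdf_K[OF that]
      by (rule order_trans) (intro add_right_mono mult_left_mono C that, simp)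
  qed
  then have "(\<integral>\<^sup>+z. cramer_energy (cdf (K z)) \<partial>M) \<le>
      (\<integral>\<^sup>+z. ennreal (2 * c) * C + 2 * ennreal \<bar>Z z\<bar> \<partial>M)"
    by (intro nn_integral_mono)
  also have "\<dots> = ennreal (2 * c) * C + 2 * (\<integral>\<^sup>+z. ennreal \<bar>Z z\<bar> \<partial>M)"
    by (simp add: nn_integral_add nn_integral_cmult emeasure_space_1)
  finally show "cramer_energy (\<lambda>x. \<integral>z. F z ((x - Z z) / c) \<partial>M) \<le>
      ennreal (2 * c) * C + 2 * (\<integral>\<^sup>+z. ennreal \<bar>Z z\<bar> \<partial>M)"
    unfolding G using cramer_energy_bind_le[OF K] by (rule order_trans[rotated])
qed

section \<open>The operator on the decision process\<close>

lemma policy_transition_in_prob_algebra: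
  assumes [measurable]: "P \<in> S \<Otimes>\<^sub>M A \<rightarrow>\<^sub>M prob_algebra S" "\<pi> \<in> S \<rightarrow>\<^sub>M prob_algebra A"
    and z: "z \<in> space (S \<Otimes>\<^sub>M A)"
  shows "policy_transition S A P \<pi> z \<in> space (prob_algebra (S \<Otimes>\<^sub>M A))"
proof -
  have "policy_transition S A P \<pi> \<in> S \<Otimes>\<^sub>M A \<rightarrow>\<^sub>M prob_algebra (S \<Otimes>\<^sub>M A)"
    unfolding policy_transition_def by measurable
  from measurable_space[OF this z] show ?thesis .
qed

theorem proposition5:
  fixes S :: "'s measure" and A :: "'a measure"
    and P :: "'s \<times> 'a \<Rightarrow> 's measure"
    and R :: "'s \<times> 'a \<times> 's \<Rightarrow> real"
    and \<gamma> \<alpha> :: real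
    and \<nu> :: "'a measure"
    and \<pi> :: "'s \<Rightarrow> 'a measure"
    and p :: "'s \<Rightarrow> 'a \<Rightarrow> real"
  assumes mdp: "discounted_mdp S A P R \<gamma>"
    and alpha: "0 < \<alpha>"
    and policy: "stationary_policy S A \<nu> \<pi> p"
    and log_well_defined: "\<forall>s\<in>space S. AE a in \<pi> s. 0 < p s a"
    and bounded_mean:
      "(SUP (s, a)\<in>space (S \<Otimes>\<^sub>M A).
          \<integral>\<^sup>+(s', a'). ennreal \<bar>R (s, a, s') - \<gamma> * \<alpha> * ln (p s' a')\<bar>
            \<partial>policy_transition S A P \<pi> (s, a)) < \<infinity>"
    and measurable_expectation:
      "\<forall>F\<in>cdf_fields S A. \<forall>x.
         (\<lambda>(s, a). \<integral>(s', a'). F (s', a') ((x - R (s, a, s')) / \<gamma> + \<alpha> * ln (p s' a'))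
            \<partial>policy_transition S A P \<pi> (s, a)) \<in> borel_measurable (S \<Otimes>\<^sub>M A)"
  shows "\<forall>F\<in>cdf_fields S A. T_cdf S A P R \<gamma> \<alpha> \<pi> p F \<in> cdf_fields S A"
proof
  fix F assume F: "F \<in> cdf_fields S A"
  interpret discounted_mdp S A P R \<gamma> by fact
  interpret stationary_policy S A \<nu> \<pi> p by fact
  define M where "M = policy_transition S A P \<pi>"
  define Z where "Z z = (\<lambda>(s', a'). R (fst z, snd z, s') - \<gamma> * \<alpha> * ln (p s' a'))" for z
  define C where "C = (SUP z\<in>space (S \<Otimes>\<^sub>M A). cramer_energy (F z))"
  define B where "B = (SUP z\<in>space (S \<Otimes>\<^sub>M A). \<integral>\<^sup>+w. ennreal \<bar>Z z w\<bar> \<partial>M z)"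
  have FQ: "\<And>z. z \<in> space (S \<Otimes>\<^sub>M A) \<Longrightarrow> \<exists>Q. real_distribution Q \<and> F z = cdf Q"
    and F_meas: "\<And>x. (\<lambda>z. F z x) \<in> borel_measurable (S \<Otimes>\<^sub>M A)"
    and C: "C < \<infinity>"
    using F by (auto simp: mem_cdf_fields_iff C_def)
  have B: "B < \<infinity>"
    using bounded_mean by (simp add: B_def Z_def M_def split_beta')
  have T: "T_cdf S A P R \<gamma> \<alpha> \<pi> p F z = (\<lambda>x. \<integral>w. F w ((x - Z z w) / \<gamma>) \<partial>M z)" for z
  proof -
    \<comment> \<open>Dividing by \<gamma> must leave \<alpha> times the logarithm, so the shift
      \<open>Z\<close> carries the factor \<gamma> \<alpha>. Its absolute value is the integrand of
      \<open>bounded_mean\<close>.\<close>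
    have "(x - R (fst z, snd z, s')) / \<gamma> + \<alpha> * l = (x - (R (fst z, snd z, s') - \<gamma> * \<alpha> * l)) / \<gamma>"
      for x l s' using discount by (simp add: field_simps)
    then show ?thesis
      by (simp add: T_cdf_def Z_def M_def split_beta')
  qed
  \<comment> \<open>The bound involves only the suprema \<open>C\<close> and \<open>B\<close>, hence
    is uniform in \<open>z\<close>.\<close>
  have main: "(\<exists>Q. real_distribution Q \<and> T_cdf S A P R \<gamma> \<alpha> \<pi> p F z = cdf Q) \<and>
      cramer_energy (T_cdf S A P R \<gamma> \<alpha> \<pi> p F z) \<le> ennreal (2 * \<gamma>) * C + 2 * B"
    if z: "z \<in> space (S \<Otimes>\<^sub>M A)" for z
  proof -
    have sets_M[measurable_cong]: "sets (M z) = sets (S \<Otimes>\<^sub>M A)" and "prob_space (M z)"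
      using policy_transition_in_prob_algebra[OF transition_kernel policy_kernel z]
      by (auto simp: M_def space_prob_algebra)
    then interpret M: prob_space "M z" by simp
    have space_M: "space (M z) = space (S \<Otimes>\<^sub>M A)"
      using sets_M by (rule sets_eq_imp_space_eq)
    note measurable_reward[measurable] measurable_density[measurable]
    \<comment> \<open>The current pair is fixed while the next one varies, so its components enter
      the measurability of \<open>Z z\<close> as constants.\<close>
    have [measurable]: "fst z \<in> space S" "snd z \<in> space A"
      using z by (auto simp: space_pair_measure)
    have Z: "Z z \<in> borel_measurable (M z)"
      unfolding Z_def by measurable
    have F_M: "(\<lambda>w. F w x) \<in> borel_measurable (M z)" for x
      using F_meas[of x] by measurable
    have FQ_M: "\<exists>Q. real_distribution Q \<and> F w = cdf Q" if "w \<in> space (M z)" for w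
      using FQ that by (simp add: space_M)
    have "cramer_energy (F w) \<le> C" if "w \<in> space (M z)" for w
      using that unfolding C_def space_M by (rule SUP_upper)
    then have "cramer_energy (T_cdf S A P R \<gamma> \<alpha> \<pi> p F z) \<le>
        ennreal (2 * \<gamma>) * C + 2 * (\<integral>\<^sup>+w. ennreal \<bar>Z z w\<bar> \<partial>M z)"
      unfolding T by (intro M.affine_mixture(2) FQ_M F_M Z discount(1))
    also have "\<dots> \<le> ennreal (2 * \<gamma>) * C + 2 * B"
      using z unfolding B_def by (intro add_left_mono mult_left_mono SUP_upper) auto
    finally show ?thesis
      using M.affine_mixture(1)[OF FQ_M F_M Z discount(1)] by (simp add: T)
  qed
  have "(SUP z\<in>space (S \<Otimes>\<^sub>M A). cramer_energy (T_cdf S A P R \<gamma> \<alpha> \<pi> p F z)) \<le>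
      ennreal (2 * \<gamma>) * C + 2 * B"
    using main by (intro SUP_least) blast
  also have "\<dots> < \<infinity>"
    using B C by (simp add: ennreal_mult_less_top)
  \<comment> \<open>Measurability of the new field in the state-action pair is
    \<open>measurable_expectation\<close> applied to \<open>F\<close>.\<close>
  finally show "T_cdf S A P R \<gamma> \<alpha> \<pi> p F \<in> cdf_fields S A"
    using main measurable_expectation F by (auto simp: mem_cdf_fields_iff T_cdf_def split_beta')
qed

end
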